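(* Let $\lambda>0$, $c<d$ real numbers, let $A$ be a linear map from $X=\mathbb{R}^{m\times n}$ to a Euclidean space, let $f$ be a vector in that space, and assume (A1) $\mathcal{N}(\nabla)\cap\mathcal{N}(A)=\{0\}$, where $\mathcal N$ denotes the null space. Let $\epsilon>0$. Then there is $\bar\rho>0$, depending only on $\lambda,A,m,n,c,d,\epsilon$, such that for every $\rho_2\ge\bar\rho$ the following holds. Let $\{(u^{(k)},\mathbf h^{(k)},\mathbf b_2^{(k)})\}_{k\ge 0}$ be generated by the ADMM scheme $$u^{(k+1)}=\arg\min_u \mathcal L_{\mathrm{box}}(u,\mathbf h^{(k)};\mathbf b_2^{(k)}),\quad \mathbf h^{(k+1)}\in\arg\min_{\mathbf h}\mathcal L_{\mathrm{box}}(u^{(k+1)},\mathbf h;\mathbf b_2^{(k)}),\quad \mathbf b_2^{(k+1)}=\mathbf b_2^{(k)}+\nabla u^{(k+1)}-\mathbf h^{(k+1)},$$ and suppose that (A3) $\|\mathbf h^{(k)}\|_2\ge\epsilon$ for all $k$. Then $\{(u^{(k)},\mathbf h^{(k)})\}$ always has a subsequence that converges to a critical point of the box-constrained problem $\min_u \frac{\|\nabla u\|_1}{\|\nabla u\|_2}+\frac\lambda2\|Au-f\|_2^2$ s.t. $u\in[c,d]$, in its equivalent split form $$\min_{u,\mathbf h}\ \frac{\|\nabla u\|_1}{\|\mathbf h\|_2}+\frac{\lambda}{2}\|Au-f\|_2^2+\Pi_{[c,d]}(u)\quad\text{s.t.}\quad \mathbf h=\nabla u .$$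
   Context: $X=\mathbb{R}^{m\times n}$ and $Y=X\times X$, with inner products $\langle x,y\rangle_X=\sum_{i,j}x_{ij}y_{ij}$ and $\langle\mathbf p,\mathbf q\rangle_Y=\sum_{i,j}\sum_{l=1}^2 p_{ij,l}q_{ij,l}$; $\|\cdot\|_2$ denotes the induced Euclidean norms (on $X$, on $Y$ and on the data space). The discrete gradient is the linear map $\nabla:X\to Y$, $\nabla u=(\nabla_x u,\nabla_y u)$, where $\nabla_x,\nabla_y$ are forward differences in the two grid directions (with a fixed standard boundary convention, e.g. periodic, or zero difference at the boundary). $\|\nabla u\|_1=\|\nabla_x u\|_1+\|\nabla_y u\|_1$ is the anisotropic total variation (sum of absolute values of all entries). The condition $u\in[c,d]$ means that all entries of $u$ lie in $[c,d]$, and $\Pi_{[c,d]}(u)$ equals $0$ if $u\in[c,d]$ and $+\infty$ otherwise. The augmented Lagrangian, for $u\in X$, $\mathbf h\in Y\setminus\{0\}$, $\mathbf b_2\in Y$ and a parameter $\rho_2>0$, is $$\mathcal L_{\mathrm{box}}(u,\mathbf h;\mathbf b_2)=\frac{\|\nabla u\|_1}{\|\mathbf h\|_2}+\frac{\lambda}{2}\|Au-f\|_2^2+\rho_2\langle\mathbf b_2,\nabla u-\mathbf h\rangle_Y+\frac{\rho_2}{2}\|\mathbf h-\nabla u\|_2^2+\Pi_{[c,d]}(u) .$$ The iteration starts from arbitrary initial values. A critical point of the split constrained problem is a pair $(u^*,\mathbf h^* )$ with $\mathbf h^*\neq 0$ for which there is $\mathbf b_2^*\in Y$ with $0\in\partial\mathcal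 L_{\mathrm{box}}(u^*,\mathbf h^*;\mathbf b_2^* )$, where $\partial$ is the (limiting) subdifferential in all three variables (in particular $\mathbf h^*=\nabla u^*$ and $u^*\in[c,d]$). *)

theory Defs
  imports "HOL-Analysis.Analysis"
begin

text \<open>
  The space of m-by-n images is \<^typ>\<open>real ^ 'n ^ 'm\<close>, with finite linearly ordered index
  types playing the roles of 1, ..., m and 1, ..., n. The library norms and inner products on this
  type, on products of it, and on the data space are the Euclidean ones.
\<close>

type_synonym ('m, 'n) image = "real ^ 'n ^ 'm"
type_synonym ('m, 'n) field2 = "('m, 'n) image \<times> ('m, 'n) image"

datatype boundary = Periodic | Zero_Difference

definition forward_diff :: "boundary \<Rightarrow> ('k :: {finite, linorder} \<Rightarrow> real) \<Rightarrow> 'k \<Rightarrow> real" where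
  "forward_diff bc v i =
     (if i < Max UNIV then v (Min {j. i < j}) - v i
      else (case bc of Periodic \<Rightarrow> v (Min UNIV) - v i | Zero_Difference \<Rightarrow> 0))"

definition grad_x ::
  "boundary \<Rightarrow> ('m :: {finite, linorder}, 'n :: {finite, linorder}) image \<Rightarrow> ('m, 'n) image" where
  "grad_x bc u = (\<chi> i j. forward_diff bc (\<lambda>i'. u $ i' $ j) i)"

definition grad_y ::
  "boundary \<Rightarrow> ('m :: {finite, linorder}, 'n :: {finite, linorder}) image \<Rightarrow> ('m, 'n) image" where
  "grad_y bc u = (\<chi> i j. forward_diff bc (\<lambda>j'. u $ i $ j') j)"

definition grad ::
  "boundary \<Rightarrow> ('m :: {finite, linorder}, 'n :: {finite, linorder}) image \<Rightarrow> ('m, 'n) field2" where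
  "grad bc u = (grad_x bc u, grad_y bc u)"

definition l1_norm :: "('m :: finite, 'n :: finite) image \<Rightarrow> real" where
  "l1_norm x = (\<Sum>i\<in>UNIV. \<Sum>j\<in>UNIV. \<bar>x $ i $ j\<bar>)"

definition l1_norm2 :: "('m :: finite, 'n :: finite) field2 \<Rightarrow> real" where
  "l1_norm2 p = l1_norm (fst p) + l1_norm (snd p)"

definition box_indicator :: "real \<Rightarrow> real \<Rightarrow> ('m :: finite, 'n :: finite) image \<Rightarrow> ereal" where
  "box_indicator c d u = (if \<forall>i j. u $ i $ j \<in> {c..d} then 0 else \<infinity>)"

text \<open>
  The augmented Lagrangian is meaningful only for nonzero \<open>h\<close>; its value at \<open>h = 0\<close> (where the
  library convention \<open>x / 0 = 0\<close> applies) is never used below: minimisation over \<open>h\<close> is restricted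
  to nonzero \<open>h\<close>, and subdifferentials, which are local, are taken only at points with
  nonzero \<open>h\<close>.
\<close>

definition L_box ::
  "boundary \<Rightarrow> real \<Rightarrow> (('m :: {finite, linorder}, 'n :: {finite, linorder}) image \<Rightarrow> 'e :: euclidean_space)
    \<Rightarrow> 'e \<Rightarrow> real \<Rightarrow> real \<Rightarrow> real \<Rightarrow> ('m, 'n) image \<Rightarrow> ('m, 'n) field2 \<Rightarrow> ('m, 'n) field2 \<Rightarrow> ereal" where
  "L_box bc lam A f c d rho u h b =
     ereal (l1_norm2 (grad bc u) / norm h + lam / 2 * (norm (A u - f))\<^sup>2
            + rho * (b \<bullet> (grad bc u - h)) + rho / 2 * (norm (h - grad bc u))\<^sup>2)
     + box_indicator c d u"

definition regular_subdifferential :: "('a :: euclidean_space \<Rightarrow> ereal) \<Rightarrow> 'a \<Rightarrow> 'a set" where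
  "regular_subdifferential F x =
     {v. \<bar>F x\<bar> \<noteq> \<infinity> \<and>
         0 \<le> Liminf (at x) (\<lambda>y. (F y - F x - ereal (v \<bullet> (y - x))) / ereal (norm (y - x)))}"

definition limiting_subdifferential :: "('a :: euclidean_space \<Rightarrow> ereal) \<Rightarrow> 'a \<Rightarrow> 'a set" where
  "limiting_subdifferential F x =
     {v. \<bar>F x\<bar> \<noteq> \<infinity> \<and>
         (\<exists>xs vs. xs \<longlonglongrightarrow> x \<and> (\<lambda>k. F (xs k)) \<longlonglongrightarrow> F x \<and>
                  (\<forall>k. vs k \<in> regular_subdifferential F (xs k)) \<and> vs \<longlonglongrightarrow> v)}"

definition critical_point ::
  "boundary \<Rightarrow> real \<Rightarrow> (('m :: {finite, linorder}, 'n :: {finite, linorder}) image \<Rightarrow> 'e :: euclidean_space)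
    \<Rightarrow> 'e \<Rightarrow> real \<Rightarrow> real \<Rightarrow> real \<Rightarrow> ('m, 'n) image \<Rightarrow> ('m, 'n) field2 \<Rightarrow> bool" where
  "critical_point bc lam A f c d rho u h \<longleftrightarrow>
     h \<noteq> 0 \<and>
     (\<exists>b. 0 \<in> limiting_subdifferential (\<lambda>(u', h', b'). L_box bc lam A f c d rho u' h' b') (u, h, b))"

definition admm_sequence ::
  "boundary \<Rightarrow> real \<Rightarrow> (('m :: {finite, linorder}, 'n :: {finite, linorder}) image \<Rightarrow> 'e :: euclidean_space)
    \<Rightarrow> 'e \<Rightarrow> real \<Rightarrow> real \<Rightarrow> real
    \<Rightarrow> (nat \<Rightarrow> ('m, 'n) image) \<Rightarrow> (nat \<Rightarrow> ('m, 'n) field2) \<Rightarrow> (nat \<Rightarrow> ('m, 'n) field2) \<Rightarrow> bool" where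
  "admm_sequence bc lam A f c d rho u h b \<longleftrightarrow>
     (\<forall>k. is_arg_min (\<lambda>u'. L_box bc lam A f c d rho u' (h k) (b k)) (\<lambda>_. True) (u (Suc k)) \<and>
          is_arg_min (\<lambda>h'. L_box bc lam A f c d rho (u (Suc k)) h' (b k)) (\<lambda>h'. h' \<noteq> 0) (h (Suc k)) \<and>
          b (Suc k) = b k + grad bc (u (Suc k)) - h (Suc k))"

end

theory Submission
  imports Defs
begin

text \<open>
  The augmented Lagrangian acts as a Lyapunov function for the scheme.

  Completing the square, the step in \<open>h\<close> minimises \<open>J u / norm h + rho / 2 * (norm (h - D u - b))\<^sup>2\<close>,
  where \<open>D\<close> is the discrete gradient and \<open>J u\<close> the anisotropic total variation of \<open>u\<close>. Its
  first-order condition says that \<open>rho *\<^sub>R b (Suc k)\<close> equals \<open>- J u *\<^sub>R (h /\<^sub>R norm h ^ 3)\<close> at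
  the new iterates. Since \<open>u\<close> stays in a bounded box and \<open>norm h \<ge> eps\<close>, the right-hand side is
  bounded and Lipschitz in \<open>(u, h)\<close> with constants independent of \<open>rho\<close> (\<open>multiplier_change\<close>).
  Hence the multiplier step raises the Lagrangian by only
  \<open>rho * (norm (b (Suc k) - b k))\<^sup>2\<close>, which is \<open>1 / rho\<close> times a quadratic in the changes of \<open>u\<close>
  and \<open>h\<close>.

  The other two steps lower it. The step in \<open>u\<close> gains a fixed multiple of the squared change,
  because the null space condition makes the quadratic part in \<open>u\<close> strongly convex, with a modulus
  independent of \<open>rho \<ge> 1\<close> (\<open>u_step_descent\<close>). The step in \<open>h\<close> gains about \<open>rho / 2\<close> times the
  squared change, because \<open>1 / norm h\<close> lies above its tangents up to a quadratic error
  (\<open>inverse_norm_quadratic_lower_bound\<close>, \<open>h_step_descent\<close>). For large \<open>rho\<close> the gains win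
  (\<open>lagrangian_descent\<close>); the Lagrangian is bounded below along the iterates, so all successive
  changes tend to zero. By compactness a subsequence converges, and its limit is feasible,
  minimises the Lagrangian in \<open>u\<close> and satisfies the first-order condition in \<open>h\<close>
  (\<open>convergent_subsequence\<close>).

  Near such a limit the Lagrangian falls by at most a multiple of the squared distance, jointly in
  all three variables (\<open>quadratic_lower_bound_at_limit\<close>). Therefore zero is even a regular
  subgradient there.
\<close>

section \<open>The reciprocal of the norm\<close>

text \<open>
  The function \<open>y \<mapsto> 1 / norm y\<close> lies above its tangent at \<open>x\<close> up to a quadratic error. With
  \<open>a = norm x\<close> and \<open>b = norm y\<close> the error term without its quadratic part equals
  \<open>(a - b)\<^sup>2 * (2 * a + b) / (2 * a ^ 3 * b)\<close>, which is nonnegative.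
\<close>

lemma inverse_norm_quadratic_lower_bound:
  fixes x y :: "'a :: real_inner"
  assumes "x \<noteq> 0" "y \<noteq> 0"
  shows "1 / norm x - (x \<bullet> (y - x)) / norm x ^ 3 - (norm (y - x))\<^sup>2 / (2 * norm x ^ 3) \<le> 1 / norm y"
proof -
  define a where "a = norm x"
  define b where "b = norm y"
  have pos: "a > 0" "b > 0" using assms by (auto simp: a_def b_def)
  have "b\<^sup>2 = a\<^sup>2 + 2 * (x \<bullet> (y - x)) + (norm (y - x))\<^sup>2"
    unfolding a_def b_def power2_norm_eq_inner by (simp add: inner_diff inner_commute algebra_simps)
  hence ip: "x \<bullet> (y - x) = (b\<^sup>2 - a\<^sup>2 - (norm (y - x))\<^sup>2) / 2" by simp
  have "1 / b - (1 / a - (x \<bullet> (y - x)) / a ^ 3 - (norm (y - x))\<^sup>2 / (2 * a ^ 3))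
      = (a - b)\<^sup>2 * (2 * a + b) / (2 * a ^ 3 * b)"
    unfolding ip using pos by (simp add: field_simps power2_eq_square power3_eq_cube)
  also have "\<dots> \<ge> 0" using pos by simp
  finally show ?thesis by (simp add: a_def b_def)
qed

text \<open>Up to sign, \<open>x / norm x ^ 3\<close> is the gradient of the reciprocal of the norm.\<close>

lemma scaled_inverse_cube_norm_lipschitz:
  fixes x y :: "'a :: real_normed_vector"
  assumes "e > 0" "norm x \<ge> e" "norm y \<ge> e"
  shows "norm (x /\<^sub>R norm x ^ 3 - y /\<^sub>R norm y ^ 3) \<le> 4 / e ^ 3 * norm (x - y)"
proof -
  define a where "a = norm x"
  define b where "b = norm y"
  have ab: "a \<ge> e" "b \<ge> e" "a > 0" "b > 0" using assms by (auto simp: a_def b_def)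
  have d: "\<bar>b - a\<bar> \<le> norm (x - y)"
    unfolding a_def b_def by (metis norm_minus_commute norm_triangle_ineq3)
  have cube: "1 / (p * q * r) \<le> 1 / e ^ 3" if "p \<ge> e" "q \<ge> e" "r \<ge> e" for p q r :: real
  proof -
    have "e * e * e \<le> p * q * r" using that assms(1) by (intro mult_mono) auto
    thus ?thesis using assms(1) by (intro frac_le) (auto simp: power3_eq_cube)
  qed
  have "x /\<^sub>R a ^ 3 - y /\<^sub>R b ^ 3 = (x - y) /\<^sub>R a ^ 3 + (inverse (a ^ 3) - inverse (b ^ 3)) *\<^sub>R y"
    by (simp add: algebra_simps)
  hence "norm (x /\<^sub>R a ^ 3 - y /\<^sub>R b ^ 3)
      \<le> norm ((x - y) /\<^sub>R a ^ 3) + norm ((inverse (a ^ 3) - inverse (b ^ 3)) *\<^sub>R y)"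
    using norm_triangle_ineq by metis
  also have "norm ((x - y) /\<^sub>R a ^ 3) = 1 / (a * a * a) * norm (x - y)"
    using ab by (simp add: power3_eq_cube divide_inverse)
  also have "norm ((inverse (a ^ 3) - inverse (b ^ 3)) *\<^sub>R y) = \<bar>inverse (a ^ 3) - inverse (b ^ 3)\<bar> * b"
    by (simp add: b_def)
  also have "inverse (a ^ 3) - inverse (b ^ 3)
      = (b - a) * (1 / (a * b * b) + 1 / (a * a * b) + 1 / (a * a * a)) / b"
    using ab by (simp add: field_simps power3_eq_cube)
  also have "\<bar>\<dots>\<bar> * b = \<bar>b - a\<bar> * (1 / (a * b * b) + 1 / (a * a * b) + 1 / (a * a * a))"
    using ab by (simp add: abs_mult abs_divide)
  also have "1 / (a * a * a) * norm (x - y) + \<dots>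
      \<le> 1 / e ^ 3 * norm (x - y) + norm (x - y) * (1 / e ^ 3 + 1 / e ^ 3 + 1 / e ^ 3)"
    using ab d assms(1) by (intro add_mono mult_mono cube) auto
  finally show ?thesis by (simp add: a_def b_def algebra_simps)
qed

section \<open>The alternating scheme for a seminorm divided by a norm\<close>

text \<open>
  The finite part of the augmented Lagrangian, with a linear map \<open>D\<close> in place of the discrete
  gradient and a function \<open>J\<close> in place of \<open>u \<mapsto> l1_norm2 (grad bc u)\<close>. The box constraint is
  kept apart, as membership in a set.
\<close>

definition ratio_lagrangian ::
  "('x :: euclidean_space \<Rightarrow> 'y :: euclidean_space) \<Rightarrow> ('x \<Rightarrow> real) \<Rightarrow> ('x \<Rightarrow> 'e :: euclidean_space)
    \<Rightarrow> 'e \<Rightarrow> real \<Rightarrow> real \<Rightarrow> 'x \<Rightarrow> 'y \<Rightarrow> 'y \<Rightarrow> real" where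
  "ratio_lagrangian D J A f lam rho u h b =
     J u / norm h + lam / 2 * (norm (A u - f))\<^sup>2 + rho * (b \<bullet> (D u - h))
       + rho / 2 * (norm (h - D u))\<^sup>2"

text \<open>
  Here \<open>J\<close> is a seminorm with bound \<open>K\<close> relative to the norm and bound \<open>M\<close> on the compact convex
  constraint set \<open>S\<close>; \<open>kappa\<close> is a modulus of convexity for the quadratic part of the problem
  in \<open>u\<close>. In the lower bound for \<open>rho\<close>, the quantities \<open>K / eps\<^sup>2\<close> and \<open>4 * M / eps ^ 3\<close> are the
  Lipschitz constants of \<open>rho *\<^sub>R b\<close> with respect to \<open>u\<close> and \<open>h\<close>, and \<open>M / eps ^ 3\<close>
  compensates the nonconvexity of the reciprocal of the norm. The last assumptions describe the
  iterates.
\<close>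

locale ratio_admm =
  fixes D :: "'x :: euclidean_space \<Rightarrow> 'y :: euclidean_space"
    and J :: "'x \<Rightarrow> real"
    and A :: "'x \<Rightarrow> 'e :: euclidean_space"
    and f :: 'e
    and S :: "'x set"
    and lam rho eps K M kappa :: real
    and u :: "nat \<Rightarrow> 'x" and h b :: "nat \<Rightarrow> 'y"
  assumes linear_D: "linear D" and linear_A: "linear A"
    and J_triangle: "\<And>x y. J (x + y) \<le> J x + J y"
    and J_scale: "\<And>s x. J (s *\<^sub>R x) = \<bar>s\<bar> * J x"
    and J_bound: "\<And>x. J x \<le> K * norm x"
    and J_le_M: "\<And>x. x \<in> S \<Longrightarrow> J x \<le> M"
    and compact_S: "compact S" and convex_S: "convex S"
    and lam_pos: "lam > 0" and eps_pos: "eps > 0" and K_nonneg: "K \<ge> 0" and M_nonneg: "M \<ge> 0"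
    and kappa_pos: "kappa > 0"
    and coercive: "\<And>w. kappa * (norm w)\<^sup>2 \<le> lam * (norm (A w))\<^sup>2 + (norm (D w))\<^sup>2"
    and rho_large: "rho \<ge> 3 + 16 * (K / eps\<^sup>2)\<^sup>2 / kappa + M / eps ^ 3 + 4 * (4 * M / eps ^ 3)\<^sup>2"
    and u_in_S: "\<And>k. u (Suc k) \<in> S"
    and u_min: "\<And>k v. v \<in> S \<Longrightarrow> ratio_lagrangian D J A f lam rho (u (Suc k)) (h k) (b k)
                  \<le> ratio_lagrangian D J A f lam rho v (h k) (b k)"
    and h_min: "\<And>k y. y \<noteq> 0 \<Longrightarrow> ratio_lagrangian D J A f lam rho (u (Suc k)) (h (Suc k)) (b k)
                  \<le> ratio_lagrangian D J A f lam rho (u (Suc k)) y (b k)"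
    and b_update: "\<And>k. b (Suc k) = b k + D (u (Suc k)) - h (Suc k)"
    and h_ge: "\<And>k. norm (h k) \<ge> eps"
begin

abbreviation L :: "'x \<Rightarrow> 'y \<Rightarrow> 'y \<Rightarrow> real" where
  "L \<equiv> ratio_lagrangian D J A f lam rho"

lemma J_nonneg: "J x \<ge> 0"
proof -
  have "J 0 = 0" using J_scale[of 0 x] by simp
  thus ?thesis using J_triangle[of x "- x"] J_scale[of "-1" x] by simp
qed

lemma J_lipschitz: "\<bar>J x - J y\<bar> \<le> K * norm (x - y)"
proof -
  have "J x \<le> J (x - y) + J y" "J y \<le> J (y - x) + J x"
    using J_triangle[of "x - y" y] J_triangle[of "y - x" x] by simp_all
  moreover have "J (x - y) \<le> K * norm (x - y)" "J (y - x) \<le> K * norm (x - y)"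
    using J_bound[of "x - y"] J_bound[of "y - x"] by (simp_all add: norm_minus_commute)
  ultimately show ?thesis by linarith
qed

lemma continuous_J: "continuous_on UNIV J"
proof -
  have "K-lipschitz_on UNIV J"
    using J_lipschitz K_nonneg by (auto simp: lipschitz_on_def dist_norm)
  thus ?thesis by (rule lipschitz_on_continuous_on)
qed

lemma rho_ge:
  shows "rho \<ge> 1" and "rho / 2 - M / (2 * eps ^ 3) - 2 * (4 * M / eps ^ 3)\<^sup>2 \<ge> 1"
    and "16 * (K / eps\<^sup>2)\<^sup>2 \<le> kappa * rho"
proof -
  define p where "p = 16 * (K / eps\<^sup>2)\<^sup>2 / kappa"
  define q where "q = M / eps ^ 3"
  define r where "r = (4 * M / eps ^ 3)\<^sup>2"
  have n: "p \<ge> 0" "q \<ge> 0" "r \<ge> 0"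
    using kappa_pos M_nonneg eps_pos by (auto simp: p_def q_def r_def)
  have le: "rho \<ge> 3 + p + q + 4 * r" using rho_large by (simp add: p_def q_def r_def)
  show "rho \<ge> 1" using le n by linarith
  have "M / (2 * eps ^ 3) = q / 2" by (simp add: q_def)
  thus "rho / 2 - M / (2 * eps ^ 3) - 2 * (4 * M / eps ^ 3)\<^sup>2 \<ge> 1"
    using le n unfolding r_def[symmetric] by linarith
  have "p \<le> rho" using le n by linarith
  hence "p * kappa \<le> rho * kappa" using kappa_pos by simp
  thus "16 * (K / eps\<^sup>2)\<^sup>2 \<le> kappa * rho" using kappa_pos by (simp add: p_def mult.commute)
qed

lemma L_completed_square:
  "L v y c = J v / norm y + lam / 2 * (norm (A v - f))\<^sup>2 + rho / 2 * (norm (y - D v - c))\<^sup>2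
     - rho / 2 * (norm c)\<^sup>2"
proof -
  have square: "(norm (y - D v - c))\<^sup>2 = (norm (y - D v))\<^sup>2 + 2 * (c \<bullet> (D v - y)) + (norm c)\<^sup>2"
    unfolding power2_norm_eq_inner by (simp add: inner_diff inner_commute algebra_simps)
  show ?thesis unfolding ratio_lagrangian_def square
    by (simp add: inner_diff_right distrib_left right_diff_distrib)
qed

lemma h_nonzero: "h k \<noteq> 0"
  using h_ge[of k] eps_pos by auto

text \<open>
  The first-order condition in \<open>h\<close> determines the multiplier, which is what makes it possible to
  bound the change of \<open>b\<close> by the changes of \<open>u\<close> and \<open>h\<close>.
\<close>

lemma multiplier_eq:
  "rho *\<^sub>R b (Suc k) = - J (u (Suc k)) *\<^sub>R (h (Suc k) /\<^sub>R norm (h (Suc k)) ^ 3)"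
proof -
  let ?v = "u (Suc k)" and ?x = "h (Suc k)"
  let ?g = "\<lambda>y. J ?v * inverse (norm y) + lam / 2 * (norm (A ?v - f))\<^sup>2
                 + rho / 2 * ((y - D ?v - b k) \<bullet> (y - D ?v - b k)) - rho / 2 * (norm (b k))\<^sup>2"
  let ?g' = "\<lambda>w. J ?v * (- (inverse (norm ?x) * (w \<bullet> sgn ?x) * inverse (norm ?x)))
                 + rho / 2 * ((?x - D ?v - b k) \<bullet> w + w \<bullet> (?x - D ?v - b k))"
  have Lg: "L ?v y (b k) = ?g y" for y
    by (simp only: L_completed_square power2_norm_eq_inner divide_inverse[of "J ?v"])
  have "(?g has_derivative ?g') (at ?x)"
    using h_nonzero[of "Suc k"] by (auto intro!: derivative_eq_intros has_derivative_norm simp: inner_commute)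
  moreover have "open (- {0 :: 'y})" by (simp add: open_Compl)
  moreover have "\<forall>y \<in> - {0}. ?g ?x \<le> ?g y"
    using h_min[of _ k] unfolding Lg by simp
  ultimately have "?g' = (\<lambda>v. 0)"
    using h_nonzero[of "Suc k"] differential_zero_maxmin[of ?x "- {0}" ?g ?g'] by auto
  hence zero: "?g' w = 0" for w by meson
  have "(J ?v *\<^sub>R (?x /\<^sub>R norm ?x ^ 3) + rho *\<^sub>R b (Suc k)) \<bullet> w = 0" for w
    using zero[of w]
    unfolding b_update sgn_div_norm
    by (simp add: inner_commute inner_add inner_diff algebra_simps power3_eq_cube)
  hence "J ?v *\<^sub>R (?x /\<^sub>R norm ?x ^ 3) + rho *\<^sub>R b (Suc k) = 0"
    using inner_eq_zero_iff by blast
  thus ?thesis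
    by (metis add.commute eq_neg_iff_add_eq_0 scaleR_minus_left)
qed

lemma multiplier_change:
  "rho * norm (b (Suc (Suc k)) - b (Suc k))
     \<le> K / eps\<^sup>2 * norm (u (Suc (Suc k)) - u (Suc k)) + 4 * M / eps ^ 3 * norm (h (Suc (Suc k)) - h (Suc k))"
proof -
  let ?v = "u (Suc k)" and ?v' = "u (Suc (Suc k))"
  define x where "x = h (Suc k) /\<^sub>R norm (h (Suc k)) ^ 3"
  define x' where "x' = h (Suc (Suc k)) /\<^sub>R norm (h (Suc (Suc k))) ^ 3"
  have "rho * norm (b (Suc (Suc k)) - b (Suc k)) = norm (rho *\<^sub>R b (Suc (Suc k)) - rho *\<^sub>R b (Suc k))"
    using rho_ge(1) by (simp flip: scaleR_diff_right)
  also have "rho *\<^sub>R b (Suc (Suc k)) - rho *\<^sub>R b (Suc k) = (J ?v - J ?v') *\<^sub>R x' + J ?v *\<^sub>R (x - x')"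
    unfolding multiplier_eq x_def[symmetric] x'_def[symmetric] by (simp add: algebra_simps)
  also have "norm \<dots> \<le> \<bar>J ?v - J ?v'\<bar> * norm x' + J ?v * norm (x - x')"
    using norm_triangle_ineq[of "(J ?v - J ?v') *\<^sub>R x'" "J ?v *\<^sub>R (x - x')"] J_nonneg by simp
  also have "\<dots> \<le> (K * norm (?v' - ?v)) * (1 / eps\<^sup>2)
      + M * (4 / eps ^ 3 * norm (h (Suc (Suc k)) - h (Suc k)))"
  proof (intro add_mono mult_mono)
    show "\<bar>J ?v - J ?v'\<bar> \<le> K * norm (?v' - ?v)"
      using J_lipschitz[of ?v ?v'] by (simp add: norm_minus_commute)
    have "norm x' = 1 / (norm (h (Suc (Suc k))))\<^sup>2"
      using h_nonzero[of "Suc (Suc k)"]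
      by (simp add: x'_def field_simps power2_eq_square power3_eq_cube)
    also have "\<dots> \<le> 1 / eps\<^sup>2"
      using h_ge[of "Suc (Suc k)"] eps_pos by (intro frac_le power_mono) auto
    finally show "norm x' \<le> 1 / eps\<^sup>2" .
    show "J ?v \<le> M" by (rule J_le_M[OF u_in_S])
    show "norm (x - x') \<le> 4 / eps ^ 3 * norm (h (Suc (Suc k)) - h (Suc k))"
      using scaled_inverse_cube_norm_lipschitz[OF eps_pos h_ge[of "Suc k"] h_ge[of "Suc (Suc k)"]]
      by (simp add: x_def x'_def norm_minus_commute)
  qed (use K_nonneg M_nonneg J_nonneg in auto)
  finally show ?thesis by (simp add: field_simps)
qed

lemma multiplier_bounded: "norm (b (Suc k)) \<le> M / eps\<^sup>2"
proof -
  let ?x = "h (Suc k)"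
  have "norm (b (Suc k)) \<le> rho * norm (b (Suc k))"
    using rho_ge(1) mult_right_mono[of 1 rho "norm (b (Suc k))"] by simp
  also have "\<dots> = norm (rho *\<^sub>R b (Suc k))" using rho_ge(1) by simp
  also have "\<dots> = J (u (Suc k)) * (1 / (norm ?x)\<^sup>2)"
    unfolding multiplier_eq using h_nonzero[of "Suc k"] J_nonneg[of "u (Suc k)"]
    by (simp add: field_simps power2_eq_square power3_eq_cube)
  also have "\<dots> \<le> M * (1 / eps\<^sup>2)"
    using h_ge[of "Suc k"] eps_pos M_nonneg J_le_M[OF u_in_S] J_nonneg
    by (intro mult_mono frac_le power_mono) auto
  finally show ?thesis by simp
qed

text \<open>
  Comparing the minimiser with the midpoint of it and the previous iterate gives a quarter of
  the quadratic form; half of it would hold as well, but a quarter is enough.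
\<close>

lemma u_step_descent:
  "L (u (Suc (Suc k))) (h (Suc k)) (b (Suc k)) + kappa / 4 * (norm (u (Suc (Suc k)) - u (Suc k)))\<^sup>2
     \<le> L (u (Suc k)) (h (Suc k)) (b (Suc k))"
proof -
  interpret D: linear D by (rule linear_D)
  interpret A: linear A by (rule linear_A)
  define x where "x = u (Suc k)"
  define y where "y = u (Suc (Suc k))"
  define m where "m = (1/2) *\<^sub>R x + (1/2) *\<^sub>R y"
  define z where "z = h (Suc k)"
  define c where "c = b (Suc k)"
  have m: "m \<in> S"
    unfolding m_def x_def y_def using convex_S u_in_S by (intro convexD) auto
  have z: "norm z > 0" using h_nonzero by (simp add: z_def)
  have Lle: "L y z c \<le> L m z c" unfolding y_def z_def c_def by (rule u_min[OF m])
  have "J m \<le> (J x + J y) / 2"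
    using J_triangle[of "(1/2) *\<^sub>R x" "(1/2) *\<^sub>R y"] by (simp add: m_def J_scale)
  hence J: "J m / norm z \<le> (J x / norm z + J y / norm z) / 2"
    using z by (simp add: field_simps)
  have mid: "(norm ((1/2) *\<^sub>R p + (1/2) *\<^sub>R q))\<^sup>2
      = ((norm p)\<^sup>2 + (norm q)\<^sup>2) / 2 - (norm (q - p))\<^sup>2 / 4" for p q :: "'z :: real_inner"
    unfolding power2_norm_eq_inner by (simp add: inner_diff inner_add inner_commute field_simps)
  have half: "p - q = p - ((1/2) *\<^sub>R q + (1/2) *\<^sub>R q)" for p q :: "'z :: real_vector"
    by (simp flip: scaleR_add_left)
  have "A m - f = (1/2) *\<^sub>R (A x - f) + (1/2) *\<^sub>R (A y - f)"
    by (subst half) (simp add: m_def A.add A.scale scaleR_diff_right)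
  hence Am: "(norm (A m - f))\<^sup>2
      = ((norm (A x - f))\<^sup>2 + (norm (A y - f))\<^sup>2) / 2 - (norm (A (y - x)))\<^sup>2 / 4"
    by (simp only: mid) (simp add: A.diff)
  have "z - D m - c = (1/2) *\<^sub>R (z - D x - c) + (1/2) *\<^sub>R (z - D y - c)"
    using half[of "- (D m)" "c - z"] by (simp add: m_def D.add D.scale scaleR_diff_right)
  hence Dm: "(norm (z - D m - c))\<^sup>2
      = ((norm (z - D x - c))\<^sup>2 + (norm (z - D y - c))\<^sup>2) / 2 - (norm (D (y - x)))\<^sup>2 / 4"
    by (simp only: mid) (simp add: D.diff norm_minus_commute)
  have "L m z c \<le> (L x z c + L y z c) / 2
      - (lam * (norm (A (y - x)))\<^sup>2 + rho * (norm (D (y - x)))\<^sup>2) / 8"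
    unfolding L_completed_square Am Dm using J
    by (simp add: algebra_simps add_divide_distrib diff_divide_distrib)
  moreover have "kappa * (norm (y - x))\<^sup>2 \<le> lam * (norm (A (y - x)))\<^sup>2 + rho * (norm (D (y - x)))\<^sup>2"
    using coercive[of "y - x"] rho_ge(1) mult_right_mono[of 1 rho "(norm (D (y - x)))\<^sup>2"] by simp
  ultimately have "L y z c + kappa / 4 * (norm (y - x))\<^sup>2 \<le> L x z c"
    using Lle by argo
  thus ?thesis by (simp add: x_def y_def z_def c_def)
qed

lemma h_step_descent:
  "L (u (Suc k)) (h (Suc k)) (b k) + (rho / 2 - M / (2 * eps ^ 3)) * (norm (h (Suc k) - h k))\<^sup>2
     \<le> L (u (Suc k)) (h k) (b k)"
proof -
  define v where "v = u (Suc k)"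
  define x where "x = h (Suc k)"
  define y where "y = h k"
  define c where "c = b k"
  have nz: "x \<noteq> 0" "y \<noteq> 0" using h_nonzero by (auto simp: x_def y_def)
  have bs: "x - D v - c = - b (Suc k)"
    unfolding b_update by (simp add: x_def v_def c_def)
  have mult: "rho *\<^sub>R b (Suc k) = - J v *\<^sub>R (x /\<^sub>R norm x ^ 3)"
    unfolding x_def v_def by (rule multiplier_eq)
  have "J v * (1 / norm x - (x \<bullet> (y - x)) / norm x ^ 3 - (norm (y - x))\<^sup>2 / (2 * norm x ^ 3))
      \<le> J v * (1 / norm y)"
    using inverse_norm_quadratic_lower_bound[OF nz] J_nonneg by (intro mult_left_mono) auto
  moreover have "J v * ((x \<bullet> (y - x)) / norm x ^ 3) = - (rho * (b (Suc k) \<bullet> (y - x)))"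
  proof -
    have "rho * (b (Suc k) \<bullet> (y - x)) = (rho *\<^sub>R b (Suc k)) \<bullet> (y - x)" by simp
    thus ?thesis unfolding mult by (simp add: divide_inverse mult.commute)
  qed
  moreover have "J v * ((norm (y - x))\<^sup>2 / (2 * norm x ^ 3)) \<le> M / (2 * eps ^ 3) * (norm (y - x))\<^sup>2"
  proof -
    have "J v * (1 / (2 * norm x ^ 3)) \<le> M * (1 / (2 * eps ^ 3))"
      using J_le_M[OF u_in_S] J_nonneg M_nonneg h_ge[of "Suc k"] eps_pos
      unfolding v_def x_def by (intro mult_mono frac_le) (auto intro: power_mono)
    from mult_right_mono[OF this, of "(norm (y - x))\<^sup>2"] show ?thesis by simp
  qed
  ultimately have J: "J v / norm x + rho * (b (Suc k) \<bullet> (y - x)) - M / (2 * eps ^ 3) * (norm (y - x))\<^sup>2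
      \<le> J v / norm y"
    by (simp add: right_diff_distrib)
  have "y - D v - c = (y - x) - b (Suc k)" using bs by (simp add: algebra_simps)
  hence "(norm (y - D v - c))\<^sup>2
      = (norm (x - D v - c))\<^sup>2 + (norm (y - x))\<^sup>2 - 2 * (b (Suc k) \<bullet> (y - x))"
    unfolding \<open>y - D v - c = _\<close> bs power2_norm_eq_inner
    by (simp add: inner_diff inner_commute algebra_simps)
  hence "L v x c + (rho / 2 - M / (2 * eps ^ 3)) * (norm (y - x))\<^sup>2 \<le> L v y c"
    unfolding L_completed_square \<open>(norm (y - D v - c))\<^sup>2 = _\<close> using J by (simp add: algebra_simps)
  thus ?thesis by (simp add: v_def x_def y_def c_def norm_minus_commute)
qed

lemma b_step_ascent:
  "L (u (Suc k)) (h (Suc k)) (b (Suc k))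
     = L (u (Suc k)) (h (Suc k)) (b k) + rho * (norm (b (Suc k) - b k))\<^sup>2"
proof -
  have "D (u (Suc k)) - h (Suc k) = b (Suc k) - b k" by (simp add: b_update)
  moreover have "b (Suc k) \<bullet> (b (Suc k) - b k) = b k \<bullet> (b (Suc k) - b k) + (norm (b (Suc k) - b k))\<^sup>2"
    unfolding power2_norm_eq_inner by (simp add: inner_diff)
  ultimately show ?thesis
    unfolding ratio_lagrangian_def by (simp add: distrib_left)
qed

text \<open>
  The ascent in the multiplier step is absorbed by the two descent steps. The index starts at one
  because the initial values need not satisfy the constraint or the first-order condition.
\<close>

lemma lagrangian_descent:
  "L (u (Suc (Suc k))) (h (Suc (Suc k))) (b (Suc (Suc k)))
     + (kappa / 8 * (norm (u (Suc (Suc k)) - u (Suc k)))\<^sup>2 + (norm (h (Suc (Suc k)) - h (Suc k)))\<^sup>2)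
     \<le> L (u (Suc k)) (h (Suc k)) (b (Suc k))"
proof -
  define p where "p = norm (u (Suc (Suc k)) - u (Suc k))"
  define q where "q = norm (h (Suc (Suc k)) - h (Suc k))"
  define r where "r = norm (b (Suc (Suc k)) - b (Suc k))"
  define C where "C = K / eps\<^sup>2"
  define E where "E = 4 * M / eps ^ 3"
  have rho: "rho \<ge> 1" by (rule rho_ge)
  have "rho * r \<le> C * p + E * q"
    using multiplier_change[of k] by (simp add: p_def q_def r_def C_def E_def)
  hence "(rho * r)\<^sup>2 \<le> (C * p + E * q)\<^sup>2"
    using rho by (intro power_mono) (auto simp: r_def)
  also have "\<dots> \<le> 2 * C\<^sup>2 * p\<^sup>2 + 2 * E\<^sup>2 * q\<^sup>2"
    using zero_le_power2[of "C * p - E * q"] by (simp add: power2_eq_square algebra_simps)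
  also have "\<dots> \<le> kappa / 8 * rho * p\<^sup>2 + 2 * E\<^sup>2 * q\<^sup>2 * rho"
  proof (intro add_mono)
    have "2 * C\<^sup>2 \<le> kappa / 8 * rho" using rho_ge(3) by (simp add: C_def)
    thus "2 * C\<^sup>2 * p\<^sup>2 \<le> kappa / 8 * rho * p\<^sup>2" by (rule mult_right_mono) simp
    show "2 * E\<^sup>2 * q\<^sup>2 \<le> 2 * E\<^sup>2 * q\<^sup>2 * rho"
      using rho mult_left_mono[of 1 rho "2 * E\<^sup>2 * q\<^sup>2"] by simp
  qed
  finally have "rho * (rho * r\<^sup>2) \<le> rho * (kappa / 8 * p\<^sup>2 + 2 * E\<^sup>2 * q\<^sup>2)"
    by (simp add: power2_eq_square algebra_simps)
  hence r: "rho * r\<^sup>2 \<le> kappa / 8 * p\<^sup>2 + 2 * E\<^sup>2 * q\<^sup>2"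
    using rho by (simp add: mult_le_cancel_left)
  have "1 * q\<^sup>2 \<le> (rho / 2 - M / (2 * eps ^ 3) - 2 * E\<^sup>2) * q\<^sup>2"
    using rho_ge(2) unfolding E_def[symmetric] by (rule mult_right_mono) simp
  hence "q\<^sup>2 + 2 * E\<^sup>2 * q\<^sup>2 \<le> (rho / 2 - M / (2 * eps ^ 3)) * q\<^sup>2"
    by (simp add: algebra_simps)
  with r u_step_descent[of k] h_step_descent[of "Suc k"] b_step_ascent[of "Suc k"]
  show ?thesis by (simp add: p_def q_def r_def)
qed

lemma changes_tendsto_0:
  shows "(\<lambda>k. u (Suc k) - u k) \<longlonglongrightarrow> 0"
    and "(\<lambda>k. h (Suc k) - h k) \<longlonglongrightarrow> 0"
    and "(\<lambda>k. b (Suc k) - b k) \<longlonglongrightarrow> 0"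
proof -
  define l where "l = (\<lambda>k. L (u (Suc k)) (h (Suc k)) (b (Suc k)))"
  define p where "p = (\<lambda>k. norm (u (Suc (Suc k)) - u (Suc k)))"
  define q where "q = (\<lambda>k. norm (h (Suc (Suc k)) - h (Suc k)))"
  have desc: "l (Suc k) + (kappa / 8 * (p k)\<^sup>2 + (q k)\<^sup>2) \<le> l k" for k
    unfolding l_def p_def q_def by (rule lagrangian_descent)
  have nonneg: "kappa / 8 * (p k)\<^sup>2 \<ge> 0" "(q k)\<^sup>2 \<ge> 0" for k
    using kappa_pos by auto
  have "decseq l"
    unfolding decseq_Suc_iff
  proof
    fix k show "l (Suc k) \<le> l k" using desc[of k] nonneg[of k] by linarith
  qed
  moreover have "- (rho / 2 * (M / eps\<^sup>2)\<^sup>2) \<le> l k" for k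
  proof -
    have "rho / 2 * (norm (b (Suc k)))\<^sup>2 \<le> rho / 2 * (M / eps\<^sup>2)\<^sup>2"
      using multiplier_bounded[of k] rho_ge(1) by (intro mult_left_mono power_mono) auto
    moreover have "J (u (Suc k)) / norm (h (Suc k)) \<ge> 0" using J_nonneg by simp
    moreover have "lam / 2 * (norm (A (u (Suc k)) - f))\<^sup>2 \<ge> 0" using lam_pos by simp
    moreover have "rho / 2 * (norm (h (Suc k) - D (u (Suc k)) - b (Suc k)))\<^sup>2 \<ge> 0"
      using rho_ge(1) by simp
    ultimately show ?thesis
      unfolding l_def L_completed_square by linarith
  qed
  ultimately obtain l0 where "l \<longlonglongrightarrow> l0" using decseq_convergent by metis
  hence "(\<lambda>k. l k - l (Suc k)) \<longlonglongrightarrow> l0 - l0" by (intro tendsto_diff LIMSEQ_Suc)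
  hence lim: "(\<lambda>k. l k - l (Suc k)) \<longlonglongrightarrow> 0" by simp
  have "(\<lambda>k. (q k)\<^sup>2) \<longlonglongrightarrow> 0"
  proof (rule tendsto_sandwich[OF _ _ tendsto_const lim])
    show "\<forall>\<^sub>F k in sequentially. (q k)\<^sup>2 \<le> l k - l (Suc k)"
    proof (intro always_eventually allI)
      fix k show "(q k)\<^sup>2 \<le> l k - l (Suc k)" using desc[of k] nonneg[of k] by linarith
    qed
  qed simp
  from tendsto_real_sqrt[OF this] have q: "q \<longlonglongrightarrow> 0" by (simp add: q_def)
  have lim': "(\<lambda>k. 8 / kappa * (l k - l (Suc k))) \<longlonglongrightarrow> 0"
    by (rule tendsto_mult_right_zero[OF lim])
  have "(\<lambda>k. (p k)\<^sup>2) \<longlonglongrightarrow> 0"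
  proof (rule tendsto_sandwich[OF _ _ tendsto_const lim'])
    show "\<forall>\<^sub>F k in sequentially. (p k)\<^sup>2 \<le> 8 / kappa * (l k - l (Suc k))"
    proof (intro always_eventually allI)
      fix k
      have "kappa / 8 * (p k)\<^sup>2 \<le> l k - l (Suc k)" using desc[of k] nonneg[of k] by linarith
      thus "(p k)\<^sup>2 \<le> 8 / kappa * (l k - l (Suc k))" using kappa_pos by (simp add: field_simps)
    qed
  qed simp
  from tendsto_real_sqrt[OF this] have p: "p \<longlonglongrightarrow> 0" by (simp add: p_def)
  have lim'': "(\<lambda>k. K / eps\<^sup>2 * p k + 4 * M / eps ^ 3 * q k) \<longlonglongrightarrow> 0"
    by (intro tendsto_add_zero tendsto_mult_right_zero p q)
  have r: "(\<lambda>k. norm (b (Suc (Suc k)) - b (Suc k))) \<longlonglongrightarrow> 0"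
  proof (rule tendsto_sandwich[OF _ _ tendsto_const lim''])
    show "\<forall>\<^sub>F k in sequentially. norm (b (Suc (Suc k)) - b (Suc k))
        \<le> K / eps\<^sup>2 * p k + 4 * M / eps ^ 3 * q k"
    proof (intro always_eventually allI)
      fix k
      have "norm (b (Suc (Suc k)) - b (Suc k)) \<le> rho * norm (b (Suc (Suc k)) - b (Suc k))"
        using rho_ge(1) mult_right_mono[of 1 rho "norm (b (Suc (Suc k)) - b (Suc k))"] by simp
      also note multiplier_change[of k]
      finally show "norm (b (Suc (Suc k)) - b (Suc k)) \<le> K / eps\<^sup>2 * p k + 4 * M / eps ^ 3 * q k"
        by (simp add: p_def q_def)
    qed
  qed simp
  show "(\<lambda>k. b (Suc k) - b k) \<longlonglongrightarrow> 0"
    by (rule LIMSEQ_imp_Suc[where f = "\<lambda>k. b (Suc k) - b k", OF tendsto_norm_zero_cancel[OF r]])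
  show "(\<lambda>k. u (Suc k) - u k) \<longlonglongrightarrow> 0"
    by (rule LIMSEQ_imp_Suc[where f = "\<lambda>k. u (Suc k) - u k",
          OF tendsto_norm_zero_cancel[OF p[unfolded p_def]]])
  show "(\<lambda>k. h (Suc k) - h k) \<longlonglongrightarrow> 0"
    by (rule LIMSEQ_imp_Suc[where f = "\<lambda>k. h (Suc k) - h k",
          OF tendsto_norm_zero_cancel[OF q[unfolded q_def]]])
qed

text \<open>
  The values of \<open>h\<close> stay bounded because \<open>h (Suc k) = D (u (Suc k)) + b k - b (Suc k)\<close>. Besides
  convergence along a subsequence, the conclusion lists the optimality conditions inherited by
  the limit: minimality in \<open>u\<close>, stationarity in \<open>h\<close> and feasibility.
\<close>

lemma convergent_subsequence:
  obtains r u' h' b' where "strict_mono (r :: nat \<Rightarrow> nat)"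
    and "(\<lambda>k. u (r k)) \<longlonglongrightarrow> u'" and "(\<lambda>k. h (r k)) \<longlonglongrightarrow> h'"
    and "u' \<in> S" and "h' \<noteq> 0" and "h' = D u'"
    and "rho *\<^sub>R b' = - J u' *\<^sub>R (h' /\<^sub>R norm h' ^ 3)"
    and "\<And>v. v \<in> S \<Longrightarrow> L u' h' b' \<le> L v h' b'"
proof -
  have tD: "((\<lambda>k. D (g k)) \<longlongrightarrow> D l) F"
    and tA: "((\<lambda>k. A (g k)) \<longlongrightarrow> A l) F"
    and tJ: "((\<lambda>k. J (g k)) \<longlongrightarrow> J l) F"
    if "(g \<longlongrightarrow> l) F" for g l and F :: "nat filter"
    using that bounded_linear.tendsto[OF linear_D[unfolded linear_conv_bounded_linear]]
      bounded_linear.tendsto[OF linear_A[unfolded linear_conv_bounded_linear]]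
      continuous_on_tendsto_compose[OF continuous_J that] by auto
  let ?B = "cball (0 :: 'y) (M / eps\<^sup>2)"
  let ?z = "\<lambda>k. (u (Suc (Suc k)), b (Suc k), b (Suc (Suc k)))"
  have "compact (S \<times> ?B \<times> ?B)" by (intro compact_Times compact_S compact_cball)
  moreover have "\<forall>k. ?z k \<in> S \<times> ?B \<times> ?B"
    using u_in_S multiplier_bounded by simp
  ultimately obtain z s where s: "strict_mono (s :: nat \<Rightarrow> nat)" and z: "z \<in> S \<times> ?B \<times> ?B" "(?z \<circ> s) \<longlonglongrightarrow> z"
    unfolding compact_def by (metis (no_types, lifting))
  obtain u' b1 b' where z_eq: "z = (u', b1, b')" by (cases z)
  have u': "(\<lambda>k. u (Suc (Suc (s k)))) \<longlonglongrightarrow> u'"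
    and b1: "(\<lambda>k. b (Suc (s k))) \<longlonglongrightarrow> b1" and b': "(\<lambda>k. b (Suc (Suc (s k)))) \<longlonglongrightarrow> b'"
    using tendsto_fst[OF z(2)] tendsto_fst[OF tendsto_snd[OF z(2)]] tendsto_snd[OF tendsto_snd[OF z(2)]]
    by (simp_all add: z_eq o_def)
  have "(\<lambda>k. b (Suc (Suc (s k))) - b (Suc (s k))) \<longlonglongrightarrow> 0"
    using LIMSEQ_subseq_LIMSEQ[OF LIMSEQ_Suc[OF changes_tendsto_0(3)] s] by (simp add: o_def)
  moreover have "(\<lambda>k. b (Suc (Suc (s k))) - b (Suc (s k))) \<longlonglongrightarrow> b' - b1"
    by (intro tendsto_diff b' b1)
  ultimately have "b1 = b'" using LIMSEQ_unique by fastforce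
  have "(\<lambda>k. D (u (Suc (Suc (s k)))) + b (Suc (s k)) - b (Suc (Suc (s k)))) \<longlonglongrightarrow> D u' + b1 - b'"
    by (intro tendsto_intros tD tA tJ u' b1 b')
  hence h': "(\<lambda>k. h (Suc (Suc (s k)))) \<longlonglongrightarrow> D u'"
    unfolding \<open>b1 = b'\<close> by (simp add: b_update[of "Suc _"])
  have "(\<lambda>k. h (Suc (Suc (s k))) - (h (Suc (Suc (s k))) - h (Suc (s k)))) \<longlonglongrightarrow> D u' - 0"
    using LIMSEQ_subseq_LIMSEQ[OF LIMSEQ_Suc[OF changes_tendsto_0(2)] s]
    by (intro tendsto_diff h') (simp add: o_def)
  hence h1: "(\<lambda>k. h (Suc (s k))) \<longlonglongrightarrow> D u'" by simp
  have "eps \<le> norm (D u')"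
    using h_ge by (intro tendsto_lowerbound[OF tendsto_norm[OF h']]) auto
  hence nz: "D u' \<noteq> 0" using eps_pos by auto
  have "(\<lambda>k. rho *\<^sub>R b (Suc (Suc (s k)))) \<longlonglongrightarrow> rho *\<^sub>R b'"
    by (intro tendsto_intros tD tA tJ b')
  moreover have "(\<lambda>k. rho *\<^sub>R b (Suc (Suc (s k)))) \<longlonglongrightarrow> - J u' *\<^sub>R (D u' /\<^sub>R norm (D u') ^ 3)"
    unfolding multiplier_eq by (intro tendsto_intros tD tA tJ u' h') (use nz in auto)
  ultimately have stat: "rho *\<^sub>R b' = - J u' *\<^sub>R (D u' /\<^sub>R norm (D u') ^ 3)"
    using LIMSEQ_unique by blast
  \<comment> \<open>The minimality of \<open>u (Suc j)\<close> involves \<open>h j\<close> and \<open>b j\<close>; along the subsequence these have the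
    same limits as \<open>h (Suc j)\<close> and \<open>b (Suc j)\<close>, because the changes vanish.\<close>
  have "L u' (D u') b' \<le> L v (D u') b'" if v: "v \<in> S" for v
  proof (rule LIMSEQ_le)
    show "(\<lambda>k. L (u (Suc (Suc (s k)))) (h (Suc (s k))) (b (Suc (s k)))) \<longlonglongrightarrow> L u' (D u') b'"
      unfolding ratio_lagrangian_def
      by (intro tendsto_intros tD tA tJ u' h1 b1[unfolded \<open>b1 = b'\<close>]) (use nz in auto)
    show "(\<lambda>k. L v (h (Suc (s k))) (b (Suc (s k)))) \<longlonglongrightarrow> L v (D u') b'"
      unfolding ratio_lagrangian_def
      by (intro tendsto_intros tD tA tJ h1 b1[unfolded \<open>b1 = b'\<close>]) (use nz in auto)
    show "\<exists>N. \<forall>k\<ge>N. L (u (Suc (Suc (s k)))) (h (Suc (s k))) (b (Suc (s k)))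
        \<le> L v (h (Suc (s k))) (b (Suc (s k)))"
      using u_min[OF v] by blast
  qed
  moreover have "strict_mono (\<lambda>k. Suc (Suc (s k)))"
    using s by (simp add: strict_mono_def)
  ultimately show thesis
    using that[of "\<lambda>k. Suc (Suc (s k))" u' "D u'" b'] u' h' nz stat z(1) z_eq by simp
qed

text \<open>
  At a triple satisfying the limiting optimality conditions, the Lagrangian falls by at most a
  multiple of the squared distance, jointly in its three arguments. The nonconvex and nonsmooth
  part \<open>J v / norm y\<close> is handled by the quadratic lower bound for \<open>1 / norm y\<close>; its linear term,
  taken with \<open>J u'\<close> in place of \<open>J v\<close>, cancels against the multiplier term.
\<close>

lemma quadratic_lower_bound_at_limit:
  fixes u' :: 'x and h' b' :: 'y
  assumes "h' \<noteq> 0" and feas: "h' = D u'"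
    and stat: "rho *\<^sub>R b' = - J u' *\<^sub>R (h' /\<^sub>R norm h' ^ 3)"
    and umin: "\<And>v. v \<in> S \<Longrightarrow> L u' h' b' \<le> L v h' b'"
  obtains C where "\<And>v y c. v \<in> S \<Longrightarrow> y \<noteq> 0 \<Longrightarrow>
    L u' h' b' - C * (norm ((v, y, c) - (u', h', b')))\<^sup>2 \<le> L v y c"
proof -
  interpret D: linear D by (rule linear_D)
  obtain B where B: "B > 0" "\<And>x. norm (D x) \<le> B * norm x"
    using linear_bounded_pos[OF linear_D] by blast
  define a where "a = norm h'"
  have a: "a > 0" using assms(1) by (simp add: a_def)
  have rho: "rho \<ge> 1" by (rule rho_ge)
  define C where "C = K / a\<^sup>2 + M / (2 * a ^ 3) + rho * (B + 1) + rho / 2 * B\<^sup>2"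
  show thesis
  proof (rule that)
    fix v :: 'x and y c :: 'y assume v: "v \<in> S" and y: "y \<noteq> 0"
    define t where "t = norm ((v, y, c) - (u', h', b'))"
    have "norm (v - u') \<le> t" "norm ((y, c) - (h', b')) \<le> t"
      using norm_fst_le[of "v - u'" "(y, c) - (h', b')"] norm_snd_le[of "(y, c) - (h', b')" "v - u'"]
      by (simp_all add: t_def)
    moreover have "norm (y - h') \<le> norm ((y, c) - (h', b'))" "norm (c - b') \<le> norm ((y, c) - (h', b'))"
      using norm_fst_le[of "y - h'" "c - b'"] norm_snd_le[of "c - b'" "y - h'"] by simp_all
    ultimately have t: "norm (v - u') \<le> t" "norm (y - h') \<le> t" "norm (c - b') \<le> t" "t \<ge> 0"
      by (auto simp: t_def)
    have ip: "\<bar>h' \<bullet> (y - h')\<bar> \<le> a * t"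
      using Cauchy_Schwarz_ineq2[of h' "y - h'"] mult_left_mono[OF t(2), of a] a
      unfolding a_def by linarith
    define p where "p = (h' \<bullet> (y - h')) / a ^ 3"
    define q where "q = (norm (y - h'))\<^sup>2 / (2 * a ^ 3)"
    have "J v * (1 / a - p - q) \<le> J v * (1 / norm y)"
      unfolding a_def p_def q_def
      using inverse_norm_quadratic_lower_bound[OF assms(1) y] J_nonneg
      by (intro mult_left_mono) auto
    hence "J v / a - J v * p - J v * q \<le> J v / norm y" by (simp add: right_diff_distrib)
    moreover have "J v * q \<le> M / (2 * a ^ 3) * t\<^sup>2"
    proof -
      have "J v * q \<le> M * (t\<^sup>2 / (2 * a ^ 3))"
        unfolding q_def using J_le_M[OF v] J_nonneg M_nonneg t a
        by (intro mult_mono divide_right_mono power_mono) auto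
      thus ?thesis by simp
    qed
    moreover have "J v * p \<le> J u' * p + K / a\<^sup>2 * t\<^sup>2"
    proof -
      have "(J v - J u') * p \<le> \<bar>J v - J u'\<bar> * (\<bar>h' \<bullet> (y - h')\<bar> / a ^ 3)"
        using a abs_ge_self[of "(J v - J u') * p"]
        by (simp add: p_def abs_mult abs_divide)
      also have "\<dots> \<le> (K * t) * (a * t / a ^ 3)"
      proof (intro mult_mono divide_right_mono ip)
        show "\<bar>J v - J u'\<bar> \<le> K * t"
          using J_lipschitz[of v u'] mult_left_mono[OF t(1) K_nonneg] by linarith
      qed (use a t K_nonneg in auto)
      also have "\<dots> = K / a\<^sup>2 * t\<^sup>2"
        using a by (simp add: field_simps power2_eq_square power3_eq_cube)
      finally show ?thesis unfolding left_diff_distrib by linarith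
    qed
    moreover have "J u' * p = - (rho * (b' \<bullet> (y - h')))"
    proof -
      have "rho * (b' \<bullet> (y - h')) = (rho *\<^sub>R b') \<bullet> (y - h')" by simp
      thus ?thesis unfolding stat by (simp add: a_def p_def divide_inverse mult.commute)
    qed
    ultimately have ratio: "J v / a + rho * (b' \<bullet> (y - h')) - (K / a\<^sup>2 + M / (2 * a ^ 3)) * t\<^sup>2 \<le> J v / norm y"
      unfolding distrib_right by linarith
    have "\<bar>(c - b') \<bullet> (D v - y)\<bar> \<le> norm (c - b') * norm (D v - y)"
      by (rule Cauchy_Schwarz_ineq2)
    also have "\<dots> \<le> t * ((B + 1) * t)"
    proof (intro mult_mono t)
      have "D v - y = D (v - u') - (y - h')" by (simp add: D.diff feas)
      hence "norm (D v - y) \<le> norm (D (v - u')) + norm (y - h')"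
        using norm_triangle_ineq4 by metis
      also have "\<dots> \<le> B * t + t"
        using B(2)[of "v - u'"] B(1) t mult_left_mono[of "norm (v - u')" t B] by linarith
      finally show "norm (D v - y) \<le> (B + 1) * t" by (simp add: algebra_simps)
    qed auto
    finally have "rho * \<bar>(c - b') \<bullet> (D v - y)\<bar> \<le> rho * ((B + 1) * t\<^sup>2)"
      using rho by (simp add: power2_eq_square mult_ac)
    moreover have "rho * ((c - b') \<bullet> (D v - y)) \<ge> - (rho * \<bar>(c - b') \<bullet> (D v - y)\<bar>)"
      using rho mult_left_mono[of "- \<bar>(c - b') \<bullet> (D v - y)\<bar>" "(c - b') \<bullet> (D v - y)" rho] by simp
    ultimately have mult: "rho * ((c - b') \<bullet> (D v - y)) \<ge> - (rho * (B + 1) * t\<^sup>2)"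
      by simp
    have "norm (h' - D v) = norm (D (v - u'))" by (simp add: D.diff feas norm_minus_commute)
    also have "\<dots> \<le> B * t"
      using B(2)[of "v - u'"] B(1) t mult_left_mono[of "norm (v - u')" t B] by linarith
    finally have "(norm (h' - D v))\<^sup>2 \<le> (B * t)\<^sup>2" by (intro power_mono) auto
    hence quad: "rho / 2 * (norm (h' - D v))\<^sup>2 \<le> rho / 2 * B\<^sup>2 * t\<^sup>2"
      using rho by (simp add: power_mult_distrib)
    have "rho * (c \<bullet> (D v - y))
        = rho * (b' \<bullet> (D v - h')) - rho * (b' \<bullet> (y - h')) + rho * ((c - b') \<bullet> (D v - y))"
      by (simp add: inner_diff algebra_simps)
    moreover have "rho / 2 * (norm (y - D v))\<^sup>2 \<ge> 0" using rho by simp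
    ultimately have "L v h' b' - C * t\<^sup>2 \<le> L v y c"
      unfolding ratio_lagrangian_def C_def a_def[symmetric] distrib_right[of _ _ "t\<^sup>2"]
      using ratio mult quad unfolding distrib_right[of _ _ "t\<^sup>2"] by linarith
    with umin[OF v] show "L u' h' b' - C * (norm ((v, y, c) - (u', h', b')))\<^sup>2 \<le> L v y c"
      unfolding t_def by linarith
  qed
qed

end

section \<open>Discrete gradient, anisotropic norm and box\<close>

lemma forward_diff_add: "forward_diff bc (\<lambda>i. v i + w i) i = forward_diff bc v i + forward_diff bc w i"
  by (cases bc) (auto simp: forward_diff_def)

lemma forward_diff_scale: "forward_diff bc (\<lambda>i. s * v i) i = s * forward_diff bc v i"
  by (cases bc) (auto simp: forward_diff_def algebra_simps)

lemma linear_grad: "linear (grad bc)"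
  by (rule linearI)
    (auto simp: grad_def grad_x_def grad_y_def vec_eq_iff forward_diff_add forward_diff_scale)

lemma l1_norm_triangle: "l1_norm (x + y) \<le> l1_norm x + l1_norm y"
  unfolding l1_norm_def by (auto simp flip: sum.distrib intro!: sum_mono abs_triangle_ineq)

lemma l1_norm_scale: "l1_norm (s *\<^sub>R x) = \<bar>s\<bar> * l1_norm x"
  unfolding l1_norm_def by (simp add: abs_mult sum_distrib_left)

lemma l1_norm_le:
  fixes x :: "('m :: finite, 'n :: finite) image"
  shows "l1_norm x \<le> real CARD('m) * real CARD('n) * norm x"
proof -
  have "\<bar>x $ i $ j\<bar> \<le> norm x" for i j
    using component_le_norm_cart[of "x $ i" j] Finite_Cartesian_Product.norm_nth_le[of x i] by linarith
  hence "l1_norm x \<le> (\<Sum>i\<in>(UNIV :: 'm set). \<Sum>j\<in>(UNIV :: 'n set). norm x)"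
    unfolding l1_norm_def by (intro sum_mono)
  thus ?thesis by simp
qed

lemma l1_norm2_triangle: "l1_norm2 (p + q) \<le> l1_norm2 p + l1_norm2 q"
  using l1_norm_triangle[of "fst p" "fst q"] l1_norm_triangle[of "snd p" "snd q"]
  by (simp add: l1_norm2_def)

lemma l1_norm2_scale: "l1_norm2 (s *\<^sub>R p) = \<bar>s\<bar> * l1_norm2 p"
  by (simp add: l1_norm2_def l1_norm_scale distrib_left)

lemma l1_norm2_le:
  fixes p :: "('m :: finite, 'n :: finite) field2"
  shows "l1_norm2 p \<le> 2 * real CARD('m) * real CARD('n) * norm p"
proof -
  have "norm (fst p) \<le> norm p" "norm (snd p) \<le> norm p"
    using norm_fst_le[of "fst p" "snd p"] norm_snd_le[of "snd p" "fst p"] by simp_all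
  hence "real CARD('m) * real CARD('n) * norm (fst p) \<le> real CARD('m) * real CARD('n) * norm p"
    "real CARD('m) * real CARD('n) * norm (snd p) \<le> real CARD('m) * real CARD('n) * norm p"
    by (simp_all add: mult_left_mono)
  thus ?thesis
    using l1_norm_le[of "fst p"] l1_norm_le[of "snd p"] unfolding l1_norm2_def by linarith
qed

lemma gradient_l1_bound:
  obtains K where "K \<ge> 0" and "\<And>u :: ('m :: {finite, linorder}, 'n :: {finite, linorder}) image.
    l1_norm2 (grad bc u) \<le> K * norm u"
proof -
  let ?N = "2 * real CARD('m) * real CARD('n)"
  obtain B where B: "B > 0" "\<And>u :: ('m, 'n) image. norm (grad bc u) \<le> B * norm u"
    using linear_bounded_pos[OF linear_grad] by blast
  have "l1_norm2 (grad bc u) \<le> ?N * B * norm u" for u :: "('m, 'n) image"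
  proof -
    have "l1_norm2 (grad bc u) \<le> ?N * norm (grad bc u)" by (rule l1_norm2_le)
    also have "\<dots> \<le> ?N * (B * norm u)" by (intro mult_left_mono B) auto
    finally show ?thesis by simp
  qed
  thus thesis using B(1) by (intro that[of "?N * B"]) auto
qed

text \<open>The feasible set: the images with all entries in \<open>{c..d}\<close>.\<close>

definition image_box :: "real \<Rightarrow> real \<Rightarrow> ('m :: finite, 'n :: finite) image set" where
  "image_box c d = {u. \<forall>i j. u $ i $ j \<in> {c..d}}"

lemma image_box_eq_cbox: "image_box c d = cbox (\<chi> i j. c) (\<chi> i j. d)"
  by (auto simp: image_box_def mem_box Basis_vec_def inner_axis)

lemma compact_image_box: "compact (image_box c d)"
  unfolding image_box_eq_cbox by (rule compact_cbox)

lemma convex_image_box: "convex (image_box c d)"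
  unfolding image_box_eq_cbox by (rule convex_box)

lemma L_box_eq:
  "L_box bc lam A f c d rho u h b =
     (if u \<in> image_box c d
      then ereal (ratio_lagrangian (grad bc) (\<lambda>u. l1_norm2 (grad bc u)) A f lam rho u h b) else \<infinity>)"
  unfolding L_box_def box_indicator_def ratio_lagrangian_def image_box_def by simp

text \<open>
  The null space condition makes \<open>u \<mapsto> (sqrt lam *\<^sub>R A u, grad bc u)\<close> injective, hence bounded below.
\<close>

lemma null_space_condition_coercive:
  fixes A :: "('m :: {finite, linorder}, 'n :: {finite, linorder}) image \<Rightarrow> 'e :: euclidean_space"
  assumes "lam > 0" "linear A" and A1: "{u. grad bc u = 0} \<inter> {u. A u = 0} = {0}"
  obtains kappa where "kappa > 0"
    and "\<And>u. kappa * (norm u)\<^sup>2 \<le> lam * (norm (A u))\<^sup>2 + (norm (grad bc u))\<^sup>2"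
proof -
  interpret A: linear A by (rule assms(2))
  interpret D: linear "grad bc" by (rule linear_grad)
  let ?T = "\<lambda>u. (sqrt lam *\<^sub>R A u, grad bc u)"
  have lin: "linear ?T"
    by (rule linearI) (simp_all add: A.add A.scale D.add D.scale algebra_simps)
  have "inj ?T"
    unfolding linear_injective_0[OF lin] using A1 assms(1) by (auto simp: zero_prod_def)
  then obtain B where B: "B > 0" "\<And>u. B * norm u \<le> norm (?T u)"
    using linear_inj_bounded_below_pos[OF lin] by metis
  have "B\<^sup>2 * (norm u)\<^sup>2 \<le> lam * (norm (A u))\<^sup>2 + (norm (grad bc u))\<^sup>2" for u
  proof -
    have "(B * norm u)\<^sup>2 \<le> (norm (?T u))\<^sup>2" using B by (intro power_mono) auto
    thus ?thesis using assms(1) by (simp add: norm_Pair power_mult_distrib)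
  qed
  thus thesis using B(1) by (intro that[of "B\<^sup>2"]) auto
qed

section \<open>Criticality of the limit\<close>

text \<open>
  A function that falls by at most a multiple of the squared distance has zero as a regular
  subgradient, so constant sequences exhibit zero as a limiting subgradient.
\<close>

lemma zero_in_limiting_subdifferential:
  fixes F :: "'a :: euclidean_space \<Rightarrow> ereal"
  assumes Fx: "F x = ereal l"
    and lower: "\<forall>\<^sub>F y in at x. ereal (l - C * (norm (y - x))\<^sup>2) \<le> F y"
  shows "0 \<in> limiting_subdifferential F x"
proof -
  have lim: "((\<lambda>y. ereal (- C * norm (y - x))) \<longlongrightarrow> ereal (- C * norm (x - x))) (at x)"
    by (intro tendsto_intros)
  have "0 \<le> Liminf (at x) (\<lambda>y. (F y - F x - ereal (0 \<bullet> (y - x))) / ereal (norm (y - x)))"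
    unfolding le_Liminf_iff
  proof (intro allI impI)
    fix a :: ereal assume "a < 0"
    hence "\<forall>\<^sub>F y in at x. a < ereal (- C * norm (y - x))"
      using order_tendstoD(1)[OF lim, of a] by (simp add: zero_ereal_def)
    moreover have "\<forall>\<^sub>F y in at x. y \<noteq> x" by (simp add: eventually_at_filter)
    ultimately show "\<forall>\<^sub>F y in at x. a < (F y - F x - ereal (0 \<bullet> (y - x))) / ereal (norm (y - x))"
      using lower
    proof eventually_elim
      case (elim y)
      have n: "norm (y - x) > 0" using elim(2) by simp
      have "ereal (- C * norm (y - x)) \<le> (F y - F x - ereal (0 \<bullet> (y - x))) / ereal (norm (y - x))"
      proof (cases "F y")
        case (real r)
        hence "l - C * (norm (y - x))\<^sup>2 \<le> r" using elim(3) by simp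
        hence "- C * norm (y - x) \<le> (r - l) / norm (y - x)"
          using n by (simp add: field_simps power2_eq_square)
        thus ?thesis using n by (simp add: real Fx)
      next
        case PInf
        thus ?thesis using n by (simp add: Fx)
      next
        case MInf
        thus ?thesis using elim(3) by simp
      qed
      with elim(1) show ?case by (rule less_le_trans)
    qed
  qed
  hence "0 \<in> regular_subdifferential F x"
    by (simp add: regular_subdifferential_def Fx)
  thus ?thesis
    unfolding limiting_subdifferential_def mem_Collect_eq using Fx
    by (intro conjI exI[of _ "\<lambda>_. x"] exI[of _ "\<lambda>_. 0"]) auto
qed

lemma critical_point_if_quadratic_lower_bound:
  assumes "h \<noteq> 0" and "u \<in> image_box c d"
    and lower: "\<And>v y e. v \<in> image_box c d \<Longrightarrow> y \<noteq> 0 \<Longrightarrow>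
      ratio_lagrangian (grad bc) (\<lambda>u. l1_norm2 (grad bc u)) A f lam rho u h b
        - C * (norm ((v, y, e) - (u, h, b)))\<^sup>2
      \<le> ratio_lagrangian (grad bc) (\<lambda>u. l1_norm2 (grad bc u)) A f lam rho v y e"
  shows "critical_point bc lam A f c d rho u h"
proof -
  let ?F = "\<lambda>(u', h', b'). L_box bc lam A f c d rho u' h' b'"
  let ?l = "ratio_lagrangian (grad bc) (\<lambda>u. l1_norm2 (grad bc u)) A f lam rho u h b"
  have "((\<lambda>z. fst (snd z)) \<longlongrightarrow> fst (snd (u, h, b))) (at (u, h, b))"
    by (intro tendsto_intros)
  hence "\<forall>\<^sub>F z in at (u, h, b). fst (snd z) \<noteq> 0"
    using assms(1) by (intro tendsto_imp_eventually_ne) auto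
  hence "\<forall>\<^sub>F z in at (u, h, b). ereal (?l - C * (norm (z - (u, h, b)))\<^sup>2) \<le> ?F z"
  proof eventually_elim
    case (elim z)
    obtain v y e where z: "z = (v, y, e)" by (cases z)
    show ?case using lower[of v y e] elim by (simp add: z L_box_eq)
  qed
  moreover have "?F (u, h, b) = ereal ?l" using assms(2) by (simp add: L_box_eq)
  ultimately have "0 \<in> limiting_subdifferential ?F (u, h, b)"
    by (intro zero_in_limiting_subdifferential)
  thus ?thesis using assms(1) unfolding critical_point_def by blast
qed

theorem theorem4p6:
  fixes A :: "('m :: {finite, linorder}, 'n :: {finite, linorder}) image \<Rightarrow> 'e :: euclidean_space"
    and lam c d eps :: real
    and bc :: boundary
  assumes "lam > 0"
    and "c < d"
    and "linear A"
    and A1: "{u. grad bc u = 0} \<inter> {u. A u = 0} = {0}"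
    and "eps > 0"
  shows "\<exists>rho_bar>0. \<forall>rho\<ge>rho_bar. \<forall>f u h b.
           admm_sequence bc lam A f c d rho u h b \<and> (\<forall>k. norm (h k) \<ge> eps) \<longrightarrow>
           (\<exists>r u_star h_star. strict_mono r \<and>
              (\<lambda>k. (u (r k), h (r k))) \<longlonglongrightarrow> (u_star, h_star) \<and>
              critical_point bc lam A f c d rho u_star h_star)"
proof -
  let ?J = "\<lambda>u :: ('m, 'n) image. l1_norm2 (grad bc u)"
  let ?S = "image_box c d :: ('m, 'n) image set"
  interpret D: linear "grad bc :: ('m, 'n) image \<Rightarrow> _" by (rule linear_grad)
  obtain kappa where kappa: "kappa > 0"
    "\<And>u. kappa * (norm u)\<^sup>2 \<le> lam * (norm (A u))\<^sup>2 + (norm (grad bc u))\<^sup>2"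
    using null_space_condition_coercive[OF \<open>lam > 0\<close> \<open>linear A\<close> A1] by blast
  obtain K where K: "K \<ge> 0" "\<And>u. ?J u \<le> K * norm u"
    using gradient_l1_bound by blast
  obtain R where R: "R > 0" "\<And>u. u \<in> ?S \<Longrightarrow> norm u \<le> R"
    using compact_imp_bounded[OF compact_image_box] unfolding bounded_pos by blast
  define M where "M = K * R"
  have M: "M \<ge> 0" "\<And>u. u \<in> ?S \<Longrightarrow> ?J u \<le> M"
    using K R by (auto simp: M_def intro: order_trans[OF K(2)] mult_left_mono)
  \<comment> \<open>None of \<open>kappa\<close>, \<open>K\<close> and \<open>M\<close> depends on \<open>f\<close> or on the iterates.\<close>
  define rho_bar where
    "rho_bar = 3 + 16 * (K / eps\<^sup>2)\<^sup>2 / kappa + M / eps ^ 3 + 4 * (4 * M / eps ^ 3)\<^sup>2"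
  have "rho_bar > 0"
    unfolding rho_bar_def using kappa(1) M(1) \<open>eps > 0\<close> by (intro add_pos_nonneg) auto
  moreover have "\<exists>r u_star h_star. strict_mono r \<and> (\<lambda>k. (u (r k), h (r k))) \<longlonglongrightarrow> (u_star, h_star) \<and>
      critical_point bc lam A f c d rho u_star h_star"
    if rho: "rho \<ge> rho_bar" and seq: "admm_sequence bc lam A f c d rho u h b"
      and h_ge: "\<And>k. norm (h k) \<ge> eps" for rho f u h b
  proof -
    let ?L = "ratio_lagrangian (grad bc) ?J A f lam rho"
    have u_le: "L_box bc lam A f c d rho (u (Suc k)) (h k) (b k) \<le> L_box bc lam A f c d rho v (h k) (b k)"
      for k v
      using seq unfolding admm_sequence_def is_arg_min_def by (meson not_le)
    have "(\<chi> i j. c) \<in> ?S" using \<open>c < d\<close> by (simp add: image_box_def)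
    hence u_in: "u (Suc k) \<in> ?S" for k
      using u_le[of k "\<chi> i j. c"] by (auto simp: L_box_eq split: if_splits)
    have u_min: "?L (u (Suc k)) (h k) (b k) \<le> ?L v (h k) (b k)" if "v \<in> ?S" for k v
      using u_le[of k v] that u_in by (simp add: L_box_eq)
    have h_min: "?L (u (Suc k)) (h (Suc k)) (b k) \<le> ?L (u (Suc k)) y (b k)" if "y \<noteq> 0" for k y
    proof -
      have "L_box bc lam A f c d rho (u (Suc k)) (h (Suc k)) (b k)
          \<le> L_box bc lam A f c d rho (u (Suc k)) y (b k)"
        using seq that unfolding admm_sequence_def is_arg_min_def by (meson not_le)
      thus ?thesis using u_in by (simp add: L_box_eq)
    qed
    have b_update: "b (Suc k) = b k + grad bc (u (Suc k)) - h (Suc k)" for k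
      using seq unfolding admm_sequence_def by blast
    interpret ratio_admm "grad bc" ?J A f ?S lam rho eps K M kappa u h b
    proof (rule ratio_admm.intro)
      show "?J (x + y) \<le> ?J x + ?J y" for x y by (simp add: D.add l1_norm2_triangle)
      show "?J (s *\<^sub>R x) = \<bar>s\<bar> * ?J x" for s x by (simp add: D.scale l1_norm2_scale)
    qed (fact linear_grad \<open>linear A\<close> K M compact_image_box convex_image_box \<open>lam > 0\<close> \<open>eps > 0\<close>
          kappa rho[unfolded rho_bar_def] u_in u_min h_min b_update h_ge)+
    obtain r u' h' b' where lim: "strict_mono (r :: nat \<Rightarrow> nat)" "(\<lambda>k. u (r k)) \<longlonglongrightarrow> u'" "(\<lambda>k. h (r k)) \<longlonglongrightarrow> h'"
      and opt: "u' \<in> ?S" "h' \<noteq> 0" "h' = grad bc u'"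
        "rho *\<^sub>R b' = - ?J u' *\<^sub>R (h' /\<^sub>R norm h' ^ 3)" "\<And>v. v \<in> ?S \<Longrightarrow> ?L u' h' b' \<le> ?L v h' b'"
      using convergent_subsequence by blast
    obtain C where "\<And>v y e. v \<in> ?S \<Longrightarrow> y \<noteq> 0 \<Longrightarrow>
        ?L u' h' b' - C * (norm ((v, y, e) - (u', h', b')))\<^sup>2 \<le> ?L v y e"
      using quadratic_lower_bound_at_limit[OF opt(2-5)] by blast
    hence "critical_point bc lam A f c d rho u' h'"
      by (rule critical_point_if_quadratic_lower_bound[OF opt(2,1)])
    thus ?thesis using lim tendsto_Pair by blast
  qed
  ultimately show ?thesis by blast
qed

end
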